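(* Let $\mathcal{G}$ be a directed strongly regular graph with parameters $(v,k,t,\lambda,\mu)$ and adjacency matrix $A$. Assume that $\mathcal{G}$ is not undirected, that it is not a complete graph, and that it is not in the Hadamard exceptional case, i.e. $A+A^{T}\neq J-I$, where $J$ is the all-ones matrix and $I$ the identity matrix. Put $D=(\lambda-\mu)^2+4(t-\mu)$, $\kappa_2=\frac12(\lambda-\mu+\sqrt{D})$ and $\kappa_3=\frac12(\lambda-\mu-\sqrt{D})$ (under these assumptions $\kappa_2,\kappa_3$ are integers). Let $\phi$ be an automorphism of order $n$ of $\mathcal{G}$. Let $f$ be the number of vertices fixed by $\phi$, and let $g$ be the number of vertices that are adjacent to their image under $\phi$. Let $\mu_{0}(\cdot)$ denote the Möbius function. Then for every integer $r$ there are non-negative integers $a_d$ and $b_d$, for all positive divisors $d$ of $n$, such that $$k-r+\sum_{d\mid n}a_d\,\mu_{0}(d)(\kappa_2-r)+\sum_{d\mid n}b_d\,\mu_{0}(d)(\kappa_3-r)=-rf+g .$$ As a consequence the following equation (for suitable non-negative integers $a_d$, namely those obtained for $r=\kappa_3$) and congruence hold: $$k-\kappa_3+\sum_{d\mid n}a_d\,\mu_{0}(d)(\kappa_2-\kappa_3)=-\kappa_3f+g$$ and $$k-\kappa_3\equiv-\kappa_3f+g\pmod{\kappa_2-\kappa_3}.$$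
   Context: A directed strongly regular graph with parameters $(v,k,t,\lambda,\mu)$ is a finite directed graph on $v$ vertices without loops such that every vertex has in-degree and out-degree equal to $k$, each vertex is on a constant number $t$ of undirected edges (pairs of oppositely directed edges), for distinct vertices $i,j$ there are exactly $\lambda$ paths of length $2$ from $i$ to $j$ if there is an edge from $i$ to $j$, and exactly $\mu$ paths of length $2$ from $i$ to $j$ if there is no edge from $i$ to $j$. Its adjacency matrix $A$ is the $(0,1)$-matrix with $A_{ij}=1$ if and only if there is an edge from $i$ to $j$; it satisfies $A^2+(\mu-\lambda)A-(t-\mu)I=\mu J$ and $AJ=JA=kJ$, and its eigenvalues are $k,\kappa_2,\kappa_3$. An automorphism is a permutation of the vertices preserving directed edges and non-edges. A vertex $x$ is "adjacent to its image" if there is a directed edge from $x$ to $\phi(x)$. The graph is undirected if $A=A^{T}$. The Möbius function is written $\mu_0$ to distinguish it from the parameter $\mu$. *)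

theory Defs
  imports
    "HOL-Analysis.Analysis"
    "HOL-Computational_Algebra.Squarefree"
    "HOL-Number_Theory.Cong"
    "Graph_Theory.Pair_Digraph"
begin

text \<open>
  The vertices are the elements of a finite type, so that matrices indexed by the vertices are
  the library's \<open>int ^ 'v ^ 'v\<close>; a \<open>pair_digraph\<close> is finite, without loops and without multiple arcs.
  A path of length 2 from \<open>x\<close> to \<open>y\<close> is determined by its middle vertex.
\<close>

locale directed_srg = pair_digraph G
  for G :: "'v::finite pair_pre_digraph" +
  fixes v k t lam mu :: nat
  assumes verts_UNIV: "pverts G = UNIV"
    and card_verts: "card (pverts G) = v"
    and out_deg: "\<And>x. out_degree (with_proj G) x = k"
    and in_deg: "\<And>x. in_degree (with_proj G) x = k"
    and undirected_edges: "\<And>x. card {y. (x, y) \<in> parcs G \<and> (y, x) \<in> parcs G} = t"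
    and paths_adjacent: "\<And>x y. x \<noteq> y \<Longrightarrow> (x, y) \<in> parcs G \<Longrightarrow>
          card {z. (x, z) \<in> parcs G \<and> (z, y) \<in> parcs G} = lam"
    and paths_nonadjacent: "\<And>x y. x \<noteq> y \<Longrightarrow> (x, y) \<notin> parcs G \<Longrightarrow>
          card {z. (x, z) \<in> parcs G \<and> (z, y) \<in> parcs G} = mu"

definition adjacency_matrix :: "'v::finite pair_pre_digraph \<Rightarrow> int ^ 'v ^ 'v" where
  "adjacency_matrix G = (\<chi> x y. if (x, y) \<in> parcs G then 1 else 0)"

definition all_ones :: "int ^ 'v::finite ^ 'v" where
  "all_ones = (\<chi> x y. 1)"

definition digraph_automorphism :: "'v::finite pair_pre_digraph \<Rightarrow> ('v \<Rightarrow> 'v) \<Rightarrow> bool" where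
  "digraph_automorphism G \<phi> \<longleftrightarrow>
     bij_betw \<phi> (pverts G) (pverts G) \<and>
     (\<forall>x\<in>pverts G. \<forall>y\<in>pverts G. (\<phi> x, \<phi> y) \<in> parcs G \<longleftrightarrow> (x, y) \<in> parcs G)"

definition permutation_order :: "('v::finite \<Rightarrow> 'v) \<Rightarrow> nat" where
  "permutation_order \<phi> = (LEAST m. 0 < m \<and> \<phi> ^^ m = id)"

definition moebius_mu :: "nat \<Rightarrow> int" where
  "moebius_mu d = (if squarefree d then (-1) ^ card (prime_factors d) else 0)"

end

theory Submission
  imports Defs "HOL-Computational_Algebra.Field_as_Ring"
begin

text \<open>
  Write \<open>A\<close> for the adjacency matrix, \<open>\<alpha>\<close> and \<open>\<beta>\<close> for \<open>\<kappa>\<^sub>2\<close> and \<open>\<kappa>\<^sub>3\<close> in either order. The defining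
  equation of the graph says \<open>(A - \<alpha> I) (A - \<beta> I) = \<mu> J\<close>, so up to the factor \<open>v (\<alpha> - \<beta>)\<close> the
  projection onto the \<open>\<alpha>\<close>-eigenspace is the matrix \<open>N = v (A - \<beta> I) - (k - \<beta>) J\<close>, which has no
  denominators: \<open>N\<^sup>2 = v (\<alpha> - \<beta>) N\<close> (lemma \<open>scaled_projection_idempotent\<close>). Everything follows
  from the traces of \<open>N\<close> and of \<open>P N\<close>, where \<open>P\<close> is the permutation matrix of \<open>\<phi>\<close>.

  The algebraic tool (\<open>trace_commuting_scaled_idempotent\<close>) is that over a Euclidean ring, if
  \<open>N\<^sup>2 = c N\<close> and \<open>P\<close> commutes with \<open>N\<close>, then the trace of \<open>P N\<close> is \<open>c\<close> times the trace of \<open>P\<close> on the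
  lattice of all \<open>x\<close> with \<open>N x = c x\<close>. The lattice has a basis and \<open>P\<close> preserves it, so that trace
  lies in the ring; for \<open>P = I\<close> it is the rank.

  Over the complex numbers (a field is a Euclidean ring) and with \<open>P = I\<close>, this yields
  \<open>sqrt D (v - 1 - 2 m) = 2 k + (\<lambda> - \<mu>) (v - 1)\<close> for a natural number \<open>m\<close>: unless the right-hand
  side vanishes, \<open>D\<close> is a nonzero square and the eigenvalues are distinct integers
  (\<open>integral_eigenvalues\<close>). The right-hand side vanishes only for undirected, complete and Hadamard
  graphs (\<open>exceptional_parameters\<close>).

  Over the integers the same tool shows that the traces \<open>i\<close>, \<open>j\<close> of \<open>P\<close> on the two eigenspaces, which
  satisfy \<open>1 + i + j = tr P = f\<close> and \<open>k + i \<kappa>\<^sub>2 + j \<kappa>\<^sub>3 = tr (P A) = g\<close>, are integers; they are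
  multiplicities, hence nonnegative, if \<open>\<phi>\<close> is the identity (\<open>permuted_traces\<close>). Subtracting \<open>r\<close> times
  the first equation from the second gives the formula, once \<open>i\<close> and \<open>j\<close> are written as sums
  \<open>\<Sum> a\<^sub>d \<mu>\<^sub>0(d)\<close> over the divisors of \<open>n\<close>. For \<open>n > 1\<close> any integer is such a sum, because \<open>\<mu>\<^sub>0\<close> takes both
  values \<open>1\<close> and \<open>-1\<close> on the divisors of \<open>n\<close>; for \<open>n = 1\<close> exactly the nonnegative integers are
  (\<open>moebius_sum_represents\<close>).
\<close>

section \<open>Traces of scaled idempotents over Euclidean rings\<close>

interpretation vec_ring: module "(*s) :: 'a::comm_ring_1 \<Rightarrow> 'a ^ 'n \<Rightarrow> 'a ^ 'n"
  by unfold_locales (vector algebra_simps)+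

lemma matrix_vector_mult_scale:
  fixes M :: "'a::comm_ring_1 ^ 'n::finite ^ 'm"
  shows "M *v (a *s x) = a *s (M *v x)"
  by (simp add: vec_eq_iff matrix_vector_mult_def sum_distrib_left mult.left_commute)

lemma matrix_vector_mult_combination:
  fixes M :: "'a::comm_ring_1 ^ 'n::finite ^ 'm"
  shows "M *v (\<Sum>b\<in>B. u b *s f b) = (\<Sum>b\<in>B. u b *s (M *v f b))"
  by (induction B rule: infinite_finite_induct)
    (simp_all add: matrix_vector_right_distrib matrix_vector_mult_scale)

text \<open>
  Submodules of free modules over a Euclidean ring are free. The induction is on the coordinates on
  which the submodule may be nonzero: an element whose coordinate at the new index has minimal
  Euclidean size divides off that coordinate of all others, and what remains vanishes there.
\<close>

lemma submodule_basis_supported: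
  fixes S :: "'n::finite set" and L :: "('a::euclidean_ring ^ 'n) set"
  assumes "finite S" "vec_ring.subspace L" "\<And>x i. x \<in> L \<Longrightarrow> i \<notin> S \<Longrightarrow> x $ i = 0"
  shows "\<exists>B. finite B \<and> B \<subseteq> L \<and> vec_ring.independent B \<and> L \<subseteq> vec_ring.span B"
  using assms
proof (induction S arbitrary: L rule: finite_induct)
  case empty
  then have "L \<subseteq> {0}"
    by (auto simp: vec_eq_iff)
  then show ?case
    by (intro exI[of _ "{}"]) (auto simp: vec_ring.independent_empty)
next
  case (insert s S)
  show ?case
  proof (cases "\<forall>x\<in>L. x $ s = 0")
    case True
    show ?thesis
    proof (rule insert.IH)
      fix x i assume "x \<in> L" "i \<notin> S"
      then show "x $ i = 0"
        using True insert.prems(2)[of x i] by (cases "i = s") auto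
    qed (rule insert.prems)
  next
    case False
    then have "\<exists>x. x \<in> L \<and> x $ s \<noteq> 0"
      by blast
    then obtain p where p: "p \<in> L" "p $ s \<noteq> 0"
      and minimal: "\<And>x. x \<in> L \<Longrightarrow> x $ s \<noteq> 0 \<Longrightarrow> euclidean_size (p $ s) \<le> euclidean_size (x $ s)"
      using arg_min_natI[of "\<lambda>x. x \<in> L \<and> x $ s \<noteq> 0" _ "\<lambda>x. euclidean_size (x $ s)"]
        arg_min_nat_le[of "\<lambda>x. x \<in> L \<and> x $ s \<noteq> 0" _ "\<lambda>x. euclidean_size (x $ s)"]
      by blast
    define L' where "L' = {x \<in> L. x $ s = 0}"
    have "vec_ring.subspace L'"
      unfolding L'_def using insert.prems(1)
      by (auto simp: vec_ring.subspace_def)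
    moreover have "x $ i = 0" if "x \<in> L'" "i \<notin> S" for x i
      using that insert.prems(2)[of x i] by (cases "i = s") (auto simp: L'_def)
    ultimately obtain B where B: "finite B" "B \<subseteq> L'" "vec_ring.independent B" "L' \<subseteq> vec_ring.span B"
      using insert.IH[of L'] by blast
    have "p \<notin> B"
      using B(2) p(2) by (auto simp: L'_def)
    have "vec_ring.independent (insert p B)"
    proof
      assume "vec_ring.dependent (insert p B)"
      then obtain u where u: "(\<Sum>x\<in>insert p B. u x *s x) = 0" "\<exists>x\<in>insert p B. u x \<noteq> 0"
        using B(1) by (auto simp: vec_ring.dependent_finite)
      have "(\<Sum>x\<in>B. u x *s x) $ s = 0"
        using B(2) by (auto simp: L'_def intro!: sum.neutral)
      moreover have eq: "u p *s p + (\<Sum>x\<in>B. u x *s x) = 0"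
        using u(1) B(1) \<open>p \<notin> B\<close> by simp
      ultimately have "u p * p $ s = 0"
        by (metis add.right_neutral vector_add_component vector_smult_component zero_index)
      then have "u p = 0"
        using p(2) by simp
      then have "(\<Sum>x\<in>B. u x *s x) = 0" "\<exists>x\<in>B. u x \<noteq> 0"
        using eq u(2) by auto
      then show False
        using B(1,3) by (auto simp: vec_ring.dependent_finite)
    qed
    moreover have "L \<subseteq> vec_ring.span (insert p B)"
    proof
      fix x assume x: "x \<in> L"
      define y where "y = x - (x $ s div p $ s) *s p"
      have "y \<in> L"
        unfolding y_def using x p(1) insert.prems(1)
        by (intro vec_ring.subspace_diff vec_ring.subspace_scale)
      moreover have "y $ s = x $ s mod p $ s"
        by (simp add: y_def minus_div_mult_eq_mod)
      ultimately have "y $ s = 0"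
        using minimal[of y] mod_size_less[OF p(2), of "x $ s"] by (auto simp: not_le)
      then have "y \<in> vec_ring.span B"
        using \<open>y \<in> L\<close> B(4) by (auto simp: L'_def)
      then show "x \<in> vec_ring.span (insert p B)"
        unfolding y_def vec_ring.span_breakdown_eq by blast
    qed
    ultimately show ?thesis
      using B p(1) by (intro exI[of _ "insert p B"]) (auto simp: L'_def)
  qed
qed

corollary submodule_basis:
  fixes L :: "('a::euclidean_ring ^ 'n::finite) set"
  assumes "vec_ring.subspace L"
  obtains B where "finite B" "B \<subseteq> L" "vec_ring.independent B" "L \<subseteq> vec_ring.span B"
  using submodule_basis_supported[of UNIV L] assms by auto

text \<open>
  All columns of \<open>N\<close> lie in \<open>L = {x. N *v x = c *s x}\<close>, so \<open>N = X Y\<close> with the basis vectors of \<open>L\<close> as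
  the columns of \<open>X\<close>, and \<open>Y X = c I\<close> because \<open>N\<close> multiplies the basis by \<open>c\<close>. If \<open>P X = X R\<close>, where
  \<open>R\<close> is the matrix of \<open>P\<close> on \<open>L\<close>, then \<open>tr (P N) = tr (X R Y) = tr (R Y X) = c tr R\<close>. The sum on the
  right-hand side below is \<open>tr R\<close>.
\<close>

lemma trace_commuting_scaled_idempotent:
  fixes N P :: "'a::euclidean_ring ^ 'n::finite ^ 'n"
  assumes idem: "\<And>i j. (N ** N) $ i $ j = c * N $ i $ j" and comm: "P ** N = N ** P"
  obtains B where "finite B" "vec_ring.independent B"
    "trace (P ** N) = c * (\<Sum>b\<in>B. vec_ring.representation B (P *v b) b)"
proof -
  define L where "L = {x. N *v x = c *s x}"
  have "vec_ring.subspace L"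
    by (rule vec_ring.subspaceI)
      (simp_all add: L_def matrix_vector_right_distrib vector_add_ldistrib matrix_vector_mult_scale
        mult.commute)
  then obtain B where B: "finite B" "B \<subseteq> L" "vec_ring.independent B" "L \<subseteq> vec_ring.span B"
    by (rule submodule_basis)
  let ?coord = "vec_ring.representation B"
  have expand: "(\<Sum>b\<in>B. ?coord x b *s b) = x" if "x \<in> L" for x
    using B that by (intro vec_ring.sum_representation_eq) auto
  have columns: "column j N \<in> L" for j
    using idem by (auto simp: L_def vec_eq_iff column_def matrix_vector_mult_def matrix_matrix_mult_def)
  have invariant: "P *v b \<in> L" if "b \<in> B" for b
  proof -
    have "N *v (P *v b) = P *v (N *v b)"
      by (simp add: matrix_vector_mul_assoc comm)
    also have "\<dots> = c *s (P *v b)"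
      using B(2) that by (auto simp: L_def matrix_vector_mult_scale)
    finally show ?thesis
      by (simp add: L_def)
  qed
  \<comment> \<open>the identity \<open>Y X = c I\<close>, from expanding \<open>N *v b' = c *s b'\<close> along the columns of \<open>N\<close>\<close>
  have key: "(\<Sum>j\<in>UNIV. b' $ j * ?coord (column j N) b) = (if b = b' then c else 0)"
    if "b' \<in> B" for b b'
  proof -
    have "(\<Sum>j\<in>UNIV. b' $ j *s column j N) = c *s b'"
      using B(2) that by (auto simp: L_def matrix_mult_sum)
    then have "?coord (\<Sum>j\<in>UNIV. b' $ j *s column j N) b = ?coord (c *s b') b"
      by simp
    moreover have in_span: "column j N \<in> vec_ring.span B" for j
      using columns B(4) by blast
    then have "?coord (\<Sum>j\<in>UNIV. b' $ j *s column j N) b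
        = (\<Sum>j\<in>UNIV. b' $ j * ?coord (column j N) b)"
      by (subst vec_ring.representation_sum[OF B(3)])
        (auto intro: vec_ring.span_scale simp: vec_ring.representation_scale[OF B(3)])
    moreover have "?coord (c *s b') b = (if b = b' then c else 0)"
      using that by (simp add: vec_ring.representation_scale[OF B(3)] vec_ring.span_base
          vec_ring.representation_basis[OF B(3)])
    ultimately show ?thesis
      by simp
  qed
  have "(P ** N) $ j $ j
      = (\<Sum>b\<in>B. \<Sum>b'\<in>B. ?coord (P *v b) b' * (b' $ j * ?coord (column j N) b))" for j
  proof -
    have "(P ** N) $ j $ j = (P *v column j N) $ j"
      by (simp add: matrix_matrix_mult_def matrix_vector_mult_def column_def)
    also have "P *v column j N = P *v (\<Sum>b\<in>B. ?coord (column j N) b *s b)"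
      by (simp add: expand[OF columns])
    also have "\<dots> = (\<Sum>b\<in>B. ?coord (column j N) b *s (P *v b))"
      by (rule matrix_vector_mult_combination)
    also have "\<dots> = (\<Sum>b\<in>B. ?coord (column j N) b *s (\<Sum>b'\<in>B. ?coord (P *v b) b' *s b'))"
      by (intro sum.cong refl) (simp add: expand[OF invariant])
    also have "\<dots> $ j = (\<Sum>b\<in>B. \<Sum>b'\<in>B. ?coord (P *v b) b' * (b' $ j * ?coord (column j N) b))"
      by (simp add: sum_distrib_left mult_ac)
    finally show ?thesis .
  qed
  then have "trace (P ** N)
      = (\<Sum>j\<in>UNIV. \<Sum>b\<in>B. \<Sum>b'\<in>B. ?coord (P *v b) b' * (b' $ j * ?coord (column j N) b))"
    by (simp add: trace_def)
  also have "\<dots> = (\<Sum>b\<in>B. \<Sum>b'\<in>B. \<Sum>j\<in>UNIV. ?coord (P *v b) b' * (b' $ j * ?coord (column j N) b))"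
    by (subst sum.swap) (intro sum.cong refl sum.swap)
  also have "\<dots> = (\<Sum>b\<in>B. \<Sum>b'\<in>B. ?coord (P *v b) b' * (if b = b' then c else 0))"
    by (simp add: sum_distrib_left[symmetric] key cong: sum.cong)
  also have "\<dots> = c * (\<Sum>b\<in>B. ?coord (P *v b) b)"
    using B(1) by (simp add: if_distrib sum_distrib_left mult.commute cong: if_cong)
  finally show ?thesis
    using B(1,3) that by blast
qed

corollary trace_scaled_idempotent:
  fixes N :: "'a::euclidean_ring ^ 'n::finite ^ 'n"
  assumes idem: "\<And>i j. (N ** N) $ i $ j = c * N $ i $ j"
  obtains m where "trace N = c * of_nat m"
proof -
  have "mat 1 ** N = N ** mat 1"
    by simp
  from trace_commuting_scaled_idempotent[OF idem this]
  obtain B :: "('a ^ 'n) set" where B: "finite B" "vec_ring.independent B"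
    "trace (mat 1 ** N) = c * (\<Sum>b\<in>B. vec_ring.representation B (mat 1 *v b) b)" .
  have "(\<Sum>b\<in>B. vec_ring.representation B (mat 1 *v b) b) = (\<Sum>b\<in>B. 1)"
    by (intro sum.cong refl) (simp add: vec_ring.representation_basis[OF B(2)])
  then show ?thesis
    using that[of "card B"] B(3) by simp
qed

corollary permuted_trace_scaled_idempotent:
  fixes N :: "'a::euclidean_ring ^ 'n::finite ^ 'n"
  assumes idem: "\<And>i j. (N ** N) $ i $ j = c * N $ i $ j"
    and "bij \<phi>" and inv: "\<And>i j. N $ \<phi> i $ \<phi> j = N $ i $ j"
  shows "c dvd (\<Sum>i\<in>UNIV. N $ i $ \<phi> i)"
proof -
  \<comment> \<open>column \<open>j\<close> is the standard basis vector at index \<open>\<phi> j\<close>\<close>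
  define P :: "'a ^ 'n ^ 'n" where "P = (\<chi> i j. of_bool (i = \<phi> j))"
  have "(P ** N) $ i $ j = (N ** P) $ i $ j" for i j
  proof -
    obtain h where h: "i = \<phi> h"
      using \<open>bij \<phi>\<close> by (metis bij_pointE)
    have "(\<phi> h = \<phi> l) = (h = l)" for l
      using \<open>bij \<phi>\<close> by (auto simp: bij_def inj_def)
    then show ?thesis
      by (simp add: matrix_matrix_mult_def P_def h inv of_bool_def if_distrib if_distribR cong: if_cong)
  qed
  then have "P ** N = N ** P"
    by (simp add: vec_eq_iff)
  from trace_commuting_scaled_idempotent[OF idem this]
  obtain B where B: "trace (P ** N) = c * (\<Sum>b\<in>B. vec_ring.representation B (P *v b) b)" .
  have "trace (P ** N) = (\<Sum>i\<in>UNIV. \<Sum>j\<in>UNIV. of_bool (i = \<phi> j) * N $ j $ i)"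
    by (simp add: trace_def matrix_matrix_mult_def P_def)
  also have "\<dots> = (\<Sum>j\<in>UNIV. N $ j $ \<phi> j)"
    by (subst sum.swap) (simp add: of_bool_def if_distrib if_distribR cong: if_cong)
  finally show ?thesis
    using B by (metis dvd_triv_left)
qed


section \<open>Scaled eigenspace projections of a directed strongly regular graph\<close>

context directed_srg
begin

lemma order_eq: "CARD('v) = v"
  using card_verts verts_UNIV by simp

lemma no_loop: "(x, x) \<notin> parcs G"
  using pair_no_loops by fastforce

lemma card_out_neighbours: "card {y. (x, y) \<in> parcs G} = k"
proof -
  have "out_arcs (with_proj G) x = Pair x ` {y. (x, y) \<in> parcs G}"
    by (auto simp: out_arcs_def)
  then show ?thesis
    using out_deg[of x] by (simp add: out_degree_def card_image inj_on_def)
qed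

lemma card_in_neighbours: "card {y. (y, x) \<in> parcs G} = k"
proof -
  have "in_arcs (with_proj G) x = (\<lambda>y. (y, x)) ` {y. (y, x) \<in> parcs G}"
    by (auto simp: in_arcs_def)
  then show ?thesis
    using in_deg[of x] by (simp add: in_degree_def card_image inj_on_def)
qed

lemma
  fixes x :: 'v
  shows row_sum: "(\<Sum>y\<in>UNIV. of_bool ((x, y) \<in> parcs G) :: 'a::comm_ring_1) = of_nat k"
    and column_sum: "(\<Sum>y\<in>UNIV. of_bool ((y, x) \<in> parcs G) :: 'a) = of_nat k"
  by (simp_all add: sum_of_bool_eq card_out_neighbours card_in_neighbours)

text \<open>
  The entrywise form of \<open>A\<^sup>2 = (\<lambda> - \<mu>) A + (t - \<mu>) I + \<mu> J\<close>. It is stated over an arbitrary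
  commutative ring because both the integers and the complex numbers will be used.
\<close>

lemma adjacency_square:
  "(\<Sum>y\<in>UNIV. of_bool ((x, y) \<in> parcs G) * of_bool ((y, z) \<in> parcs G))
    = (of_nat lam - of_nat mu) * of_bool ((x, z) \<in> parcs G)
      + (of_nat t - of_nat mu) * of_bool (x = z) + (of_nat mu :: 'a::comm_ring_1)"
proof -
  have "(\<Sum>y\<in>UNIV. of_bool ((x, y) \<in> parcs G) * of_bool ((y, z) \<in> parcs G) :: 'a)
      = (\<Sum>y\<in>UNIV. of_bool ((x, y) \<in> parcs G \<and> (y, z) \<in> parcs G))"
    by (simp add: of_bool_conj)
  also have "\<dots> = of_nat (card {y. (x, y) \<in> parcs G \<and> (y, z) \<in> parcs G})"
    by (simp add: sum_of_bool_eq)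
  also have "card {y. (x, y) \<in> parcs G \<and> (y, z) \<in> parcs G}
      = (if x = z then t else if (x, z) \<in> parcs G then lam else mu)"
    using undirected_edges paths_adjacent paths_nonadjacent by auto
  finally show ?thesis
    using no_loop by (auto split: if_splits)
qed

text \<open>Comparing the sums over a row of both sides of the preceding equation.\<close>

lemma parameter_equation:
  "(of_nat k * of_nat k :: 'a::comm_ring_1) = (of_nat lam - of_nat mu) * of_nat k
     + (of_nat t - of_nat mu) + of_nat v * of_nat mu"
proof -
  fix x :: 'v
  let ?a = "\<lambda>x y. of_bool ((x, y) \<in> parcs G) :: 'a"
  have "(\<Sum>z\<in>UNIV. \<Sum>y\<in>UNIV. ?a x y * ?a y z) = of_nat k * of_nat k"
    by (subst sum.swap) (simp add: sum_distrib_left[symmetric] sum_distrib_right[symmetric] row_sum)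
  moreover have "(\<Sum>z\<in>UNIV. \<Sum>y\<in>UNIV. ?a x y * ?a y z) = (of_nat lam - of_nat mu) * of_nat k
     + (of_nat t - of_nat mu) + of_nat v * of_nat mu"
    by (simp only: adjacency_square) (simp add: sum.distrib sum_distrib_left[symmetric] row_sum order_eq)
  ultimately show ?thesis
    by simp
qed

text \<open>
  The matrix \<open>v (A - \<beta> I) - (k - \<beta>) J\<close>. If \<open>\<beta>\<close> is one of the eigenvalues \<open>\<kappa>\<^sub>2\<close>, \<open>\<kappa>\<^sub>3\<close> and \<open>\<alpha>\<close> is the other
  one, then \<open>A - \<beta> I\<close> kills the \<open>\<beta>\<close>-eigenspace and is \<open>\<alpha> - \<beta>\<close> on the \<open>\<alpha>\<close>-eigenspace; subtracting the
  multiple of \<open>J\<close> kills the all-ones vector, and the factor \<open>v\<close> keeps the matrix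
  integral for integral \<open>\<beta>\<close>.
\<close>

definition scaled_projection :: "'a::comm_ring_1 \<Rightarrow> 'a ^ 'v ^ 'v" where
  "scaled_projection \<beta> = (\<chi> x y. of_nat v * (of_bool ((x, y) \<in> parcs G) - \<beta> * of_bool (x = y))
     - (of_nat k - \<beta>))"

lemma scaled_projection_idempotent:
  fixes \<alpha> \<beta> :: "'a::comm_ring_1"
  assumes eig_sum: "\<alpha> + \<beta> = of_nat lam - of_nat mu" and eig_prod: "\<alpha> * \<beta> = of_nat mu - of_nat t"
  shows "(scaled_projection \<beta> ** scaled_projection \<beta>) $ x $ z
    = of_nat v * (\<alpha> - \<beta>) * scaled_projection \<beta> $ x $ z"
proof -
  define a :: "'v \<Rightarrow> 'v \<Rightarrow> 'a" where "a = (\<lambda>x y. of_bool ((x, y) \<in> parcs G))"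
  define d :: "'v \<Rightarrow> 'v \<Rightarrow> 'a" where "d = (\<lambda>x y. of_bool (x = y))"
  define w where "w = of_nat k - \<beta>"
  let ?v = "of_nat v :: 'a"
  have sums: "(\<Sum>y\<in>UNIV. a x y) = of_nat k" "(\<Sum>y\<in>UNIV. a y z) = of_nat k"
    by (simp_all only: a_def row_sum column_sum)
  have delta: "(\<Sum>y\<in>UNIV. d x y * h y) = h x" "(\<Sum>y\<in>UNIV. h y * d y z) = h z" for h
    by (simp_all add: d_def of_bool_def if_distrib if_distribR cong: if_cong)
  have delta_sums: "(\<Sum>y\<in>UNIV. d x y) = 1" "(\<Sum>y\<in>UNIV. d y z) = 1"
    using delta(1)[of "\<lambda>_. 1"] delta(2)[of "\<lambda>_. 1"] by simp_all
  have square: "(\<Sum>y\<in>UNIV. a x y * a y z) = (\<alpha> + \<beta>) * a x z - \<alpha> * \<beta> * d x z + of_nat mu"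
    unfolding a_def d_def adjacency_square eig_sum eig_prod by (simp add: algebra_simps)
  \<comment> \<open>the equation \<open>(A - \<alpha> I) (A - \<beta> I) = \<mu> J\<close> applied to the all-ones vector\<close>
  have rank_one: "?v * of_nat mu = (of_nat k - \<alpha>) * w"
  proof -
    have "(of_nat k - \<alpha>) * w = of_nat k * of_nat k - (\<alpha> + \<beta>) * of_nat k + \<alpha> * \<beta>"
      by (simp add: w_def algebra_simps)
    then show ?thesis
      unfolding eig_sum eig_prod parameter_equation by (simp add: algebra_simps)
  qed
  have "(scaled_projection \<beta> ** scaled_projection \<beta>) $ x $ z
      = (\<Sum>y\<in>UNIV. (?v * (a x y - \<beta> * d x y) - w) * (?v * (a y z - \<beta> * d y z) - w))"
    by (simp add: matrix_matrix_mult_def scaled_projection_def a_def d_def w_def)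
  also have "\<dots> = (\<Sum>y\<in>UNIV. ?v * ?v * (a x y * a y z) - ?v * ?v * \<beta> * (a x y * d y z)
      - ?v * ?v * \<beta> * (d x y * a y z) + ?v * ?v * \<beta> * \<beta> * (d x y * d y z)
      - ?v * w * a x y + ?v * w * \<beta> * d x y - ?v * w * a y z + ?v * w * \<beta> * d y z + w * w)"
    by (intro sum.cong refl) (simp add: algebra_simps)
  also have "\<dots> = ?v * ?v * ((\<alpha> + \<beta>) * a x z - \<alpha> * \<beta> * d x z + of_nat mu)
      - ?v * ?v * \<beta> * a x z - ?v * ?v * \<beta> * a x z + ?v * ?v * \<beta> * \<beta> * d x z
      - ?v * w * of_nat k + ?v * w * \<beta> - ?v * w * of_nat k + ?v * w * \<beta> + ?v * (w * w)"
    by (simp add: sum.distrib sum_subtractf sum_distrib_left[symmetric] sums delta delta_sums square order_eq)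
  also have "\<dots> = ?v * ?v * (\<alpha> - \<beta>) * (a x z - \<beta> * d x z) + ?v * (?v * of_nat mu) - ?v * w * w"
    by (simp add: w_def algebra_simps)
  also have "\<dots> = ?v * (\<alpha> - \<beta>) * (?v * (a x z - \<beta> * d x z) - w)"
    unfolding rank_one by (simp add: w_def algebra_simps)
  finally show ?thesis
    by (simp add: scaled_projection_def a_def d_def w_def)
qed

lemma scaled_projection_permuted_trace:
  "(\<Sum>x\<in>UNIV. scaled_projection \<beta> $ x $ \<phi> x)
    = of_nat v * (of_nat (card {x. (x, \<phi> x) \<in> parcs G}) - \<beta> * of_nat (card {x. \<phi> x = x})
        - (of_nat k - \<beta>))"
proof -
  have "(\<Sum>x\<in>UNIV. of_bool (x = \<phi> x) :: 'a) = of_nat (card {x. \<phi> x = x})"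
    by (simp add: sum_of_bool_eq eq_commute)
  moreover have "(\<Sum>x\<in>UNIV. of_bool ((x, \<phi> x) \<in> parcs G) :: 'a)
      = of_nat (card {x. (x, \<phi> x) \<in> parcs G})"
    by (simp add: sum_of_bool_eq)
  ultimately show ?thesis
    by (simp add: scaled_projection_def sum_subtractf sum_distrib_left[symmetric] order_eq
        right_diff_distrib)
qed

text \<open>
  For \<open>\<alpha> \<noteq> \<beta>\<close>, the number \<open>m\<close> is the multiplicity of the eigenvalue \<open>\<alpha>\<close>: since \<open>A\<close> has trace \<open>0\<close>, the left-hand side is the
  trace of \<open>A - \<beta> I\<close> without its eigenvalue \<open>k - \<beta>\<close> at the all-ones vector.
\<close>

lemma eigenvalue_multiplicity:
  fixes \<alpha> \<beta> :: "'a::{euclidean_ring, ring_char_0}"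
  assumes "\<alpha> + \<beta> = of_nat lam - of_nat mu" and "\<alpha> * \<beta> = of_nat mu - of_nat t"
  obtains m where "- \<beta> * of_nat v - (of_nat k - \<beta>) = (\<alpha> - \<beta>) * of_nat m"
proof -
  obtain m where "trace (scaled_projection \<beta>) = of_nat v * (\<alpha> - \<beta>) * of_nat m"
    using trace_scaled_idempotent[OF scaled_projection_idempotent[OF assms]] by blast
  moreover have "trace (scaled_projection \<beta>) = of_nat v * (- \<beta> * of_nat v - (of_nat k - \<beta>))"
    using scaled_projection_permuted_trace[of \<beta> "\<lambda>x. x"] no_loop
    by (simp add: trace_def order_eq)
  moreover have "v > 0"
    using order_eq by (metis zero_less_card_finite)
  ultimately show ?thesis
    using that[of m] by (simp add: mult.assoc)
qed

text \<open>
  For \<open>\<alpha> \<noteq> \<beta>\<close>, the quotient is the trace of \<open>\<phi>\<close> on the \<open>\<alpha>\<close>-eigenspace. It is an integer because \<open>\<phi>\<close> acts on the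
  integral eigenvectors by an integral matrix.
\<close>

lemma permuted_trace_congruence:
  fixes \<alpha> \<beta> :: int
  assumes eig: "\<alpha> + \<beta> = int lam - int mu" "\<alpha> * \<beta> = int mu - int t"
    and aut: "digraph_automorphism G \<phi>"
  shows "\<alpha> - \<beta> dvd
    int (card {x. (x, \<phi> x) \<in> parcs G}) - \<beta> * int (card {x. \<phi> x = x}) - (int k - \<beta>)"
proof -
  have "bij \<phi>" and pres: "\<And>x y. (\<phi> x, \<phi> y) \<in> parcs G \<longleftrightarrow> (x, y) \<in> parcs G"
    using aut verts_UNIV by (auto simp: digraph_automorphism_def)
  have "scaled_projection \<beta> $ \<phi> x $ \<phi> y = scaled_projection \<beta> $ x $ y" for x y
    using \<open>bij \<phi>\<close> by (simp add: scaled_projection_def pres bij_def inj_eq)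
  then have "int v * (\<alpha> - \<beta>) dvd (\<Sum>x\<in>UNIV. scaled_projection \<beta> $ x $ \<phi> x)"
    by (intro permuted_trace_scaled_idempotent[OF scaled_projection_idempotent] \<open>bij \<phi>\<close>)
      (simp_all add: eig)
  moreover have "v > 0"
    using order_eq by (metis zero_less_card_finite)
  ultimately show ?thesis
    by (simp add: scaled_projection_permuted_trace)
qed

text \<open>
  If \<open>D\<close> were not a square, the conjugate eigenvalues would have equal multiplicities \<open>(v - 1) / 2\<close>,
  and the trace of \<open>A\<close>, which is \<open>0\<close>, would be \<open>k + (\<lambda> - \<mu>) (v - 1) / 2\<close>, against the assumption. If
  \<open>D = 0\<close>, the single eigenvalue \<open>(\<lambda> - \<mu>) / 2\<close> of multiplicity \<open>v - 1\<close> leads to the same value.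
  Working over the complex numbers covers negative \<open>D\<close>.
\<close>

lemma integral_eigenvalues:
  assumes "2 * int k + (int lam - int mu) * (int v - 1) \<noteq> 0"
  obtains \<alpha> \<beta> :: int where "\<beta> < \<alpha>" "\<alpha> + \<beta> = int lam - int mu" "\<alpha> * \<beta> = int mu - int t"
proof -
  define e where "e = int lam - int mu"
  define D where "D = e\<^sup>2 + 4 * (int t - int mu)"
  define s where "s = csqrt (of_int D)"
  have s2: "s * s = of_int D"
    by (simp add: s_def flip: power2_eq_square)
  have e': "of_int e = (of_nat lam - of_nat mu :: complex)"
    by (simp add: e_def)
  obtain m where "- ((of_int e - s) / 2) * of_nat v - (of_nat k - (of_int e - s) / 2)
      = ((of_int e + s) / 2 - (of_int e - s) / 2) * (of_nat m :: complex)"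
  proof (rule eigenvalue_multiplicity)
    show "(of_int e + s) / 2 + (of_int e - s) / 2 = (of_nat lam - of_nat mu :: complex)"
      by (simp add: e' field_simps)
    show "(of_int e + s) / 2 * ((of_int e - s) / 2) = (of_nat mu - of_nat t :: complex)"
      by (simp add: field_simps s2) (simp add: D_def power2_eq_square)
  qed
  then have "s * (of_nat v - 1 - 2 * of_nat m) = 2 * of_nat k + of_int e * (of_nat v - 1)"
    by (simp add: field_simps)
  then have "s * of_int (int v - 1 - 2 * int m) = of_int (2 * int k + e * (int v - 1))"
    by simp
  then have "(s * s) * of_int ((int v - 1 - 2 * int m)\<^sup>2) = of_int ((2 * int k + e * (int v - 1))\<^sup>2)"
    by (metis of_int_power power2_eq_square power_mult_distrib)
  then have "of_int (D * (int v - 1 - 2 * int m)\<^sup>2)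
      = (of_int ((2 * int k + e * (int v - 1))\<^sup>2) :: complex)"
    by (simp only: s2 of_int_mult)
  then have sq: "D * (int v - 1 - 2 * int m)\<^sup>2 = (2 * int k + e * (int v - 1))\<^sup>2"
    by (simp only: of_int_eq_iff)
  then have "(int v - 1 - 2 * int m)\<^sup>2 dvd (2 * int k + e * (int v - 1))\<^sup>2"
    by (metis dvd_triv_right)
  then have "int v - 1 - 2 * int m dvd 2 * int k + e * (int v - 1)"
    by simp
  then obtain q where q: "2 * int k + e * (int v - 1) = (int v - 1 - 2 * int m) * q" ..
  have nz: "2 * int k + e * (int v - 1) \<noteq> 0"
    using assms by (simp add: e_def)
  then have "D = q\<^sup>2" "q \<noteq> 0"
    using sq q by (auto simp: power_mult_distrib)
  then have D': "D = \<bar>q\<bar>\<^sup>2" "\<bar>q\<bar> > 0"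
    by auto
  \<comment> \<open>\<open>D\<close> and \<open>e\<^sup>2\<close> differ by a multiple of \<open>4\<close>, so \<open>e + sqrt D\<close> can be halved\<close>
  then have "even (\<bar>q\<bar>\<^sup>2 - e\<^sup>2)"
    unfolding D_def by (metis add_diff_cancel_left' dvd_mult2 even_numeral)
  then have "even (e + \<bar>q\<bar>)" "even (e - \<bar>q\<bar>)"
    by auto
  then obtain a b where ab: "e + \<bar>q\<bar> = 2 * a" "e - \<bar>q\<bar> = 2 * b"
    unfolding dvd_def by blast
  show ?thesis
  proof (rule that[of b a])
    show "b < a"
      using ab D'(2) by linarith
    show "a + b = int lam - int mu"
      using ab e_def by linarith
    have "4 * (a * b) = (e + \<bar>q\<bar>) * (e - \<bar>q\<bar>)"
      by (simp add: ab)
    also have "\<dots> = e\<^sup>2 - \<bar>q\<bar>\<^sup>2"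
      by (simp add: algebra_simps power2_eq_square)
    also have "\<dots> = 4 * (int mu - int t)"
      using D'(1) by (simp add: D_def)
    finally show "a * b = int mu - int t"
      by simp
  qed
qed

text \<open>
  A graph without edges is undirected, so \<open>0 < k \<le> v - 1\<close>. Therefore vanishing would give \<open>\<mu> - \<lambda> = 2\<close>, where \<open>k = v - 1\<close> and the graph is complete,
  or \<open>\<mu> - \<lambda> = 1\<close>. In the latter case \<open>v = 2 k + 1\<close>, and the parameter equation becomes
  \<open>t = k (k + 1 - 2 \<mu>)\<close>. As \<open>0 \<le> t \<le> k\<close>, either \<open>t = k\<close> and every edge is undirected, or \<open>t = 0\<close>
  and the \<open>2 k = v - 1\<close> in- and out-neighbours of a vertex are all other vertices.
\<close>

lemma exceptional_parameters:
  assumes nsym: "adjacency_matrix G \<noteq> transpose (adjacency_matrix G)"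
    and ncomplete: "adjacency_matrix G \<noteq> all_ones - mat 1"
    and nhadamard: "adjacency_matrix G + transpose (adjacency_matrix G) \<noteq> all_ones - mat 1"
  shows "2 * int k + (int lam - int mu) * (int v - 1) \<noteq> 0"
proof
  assume eq: "2 * int k + (int lam - int mu) * (int v - 1) = 0"
  let ?O = "\<lambda>x. {y. (x, y) \<in> parcs G}" and ?I = "\<lambda>x. {y. (y, x) \<in> parcs G}"
  have entry: "(adjacency_matrix G = B) \<longleftrightarrow>
      (\<forall>x y. (if (x, y) \<in> parcs G then 1 else 0) = B $ x $ y)" for B
    by (simp add: adjacency_matrix_def vec_eq_iff)
  have card_others: "card (UNIV - {x :: 'v}) = v - 1" for x
    using order_eq by (simp add: card_Diff_singleton)
  have sub: "?O x \<subseteq> UNIV - {x}" "?I x \<subseteq> UNIV - {x}" for x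
    using no_loop by auto
  obtain x :: 'v where True by simp
  have "v > 0"
    using order_eq by (metis zero_less_card_finite)
  have "k \<le> v - 1"
    using card_mono[OF _ sub(1)[of x]] by (simp only: card_others card_out_neighbours) simp
  have "k \<noteq> 0"
  proof
    assume "k = 0"
    then have "parcs G = {}"
      using card_out_neighbours by fastforce
    then show False
      using nsym by (simp add: adjacency_matrix_def transpose_def)
  qed
  have "k \<noteq> v - 1"
  proof
    assume "k = v - 1"
    then have "?O x = UNIV - {x}" for x
      using sub by (intro card_subset_eq) (simp_all only: card_others card_out_neighbours, simp)
    then have "(x, y) \<in> parcs G \<longleftrightarrow> x \<noteq> y" for x y
      by blast
    then show False
      using ncomplete unfolding entry by (auto simp: all_ones_def mat_def split: if_splits)
  qed
  define e where "e = int mu - int lam"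
  define u where "u = int v - 1"
  have u: "int k < u" "int k > 0" "u * e = 2 * int k"
    using \<open>k \<le> v - 1\<close> \<open>k \<noteq> v - 1\<close> \<open>k \<noteq> 0\<close> \<open>v > 0\<close> eq by (auto simp: u_def e_def algebra_simps)
  have "e > 0"
    using u by (metis mult_pos_pos zero_less_mult_pos zero_less_numeral order.strict_trans)
  moreover have "e < 2"
  proof (rule ccontr)
    assume "\<not> e < 2"
    then have "u * 2 \<le> u * e"
      using u by (intro mult_left_mono) auto
    then show False
      using u by simp
  qed
  ultimately have "e = 1"
    by simp
  then have mu_lam: "int lam = int mu - 1" and v: "int v = 2 * int k + 1"
    using u(3) by (auto simp: e_def u_def)
  have t_eq: "int t = int k * (int k + 1 - 2 * int mu)"
    using parameter_equation[where 'a = int] unfolding mu_lam v by (simp add: algebra_simps)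
  have t_card: "card (?O x \<inter> ?I x) = t" for x
    using undirected_edges[of x] by (simp add: Collect_conj_eq)
  have "t \<le> k"
    using card_mono[of "?O x" "?O x \<inter> ?I x"] by (simp add: t_card card_out_neighbours)
  then have "int k * (int k + 1 - 2 * int mu) \<le> int k * 1" "int k * (int k + 1 - 2 * int mu) \<ge> int k * 0"
    using t_eq by simp_all
  then have "int k + 1 - 2 * int mu \<le> 1" "int k + 1 - 2 * int mu \<ge> 0"
    using u(2) by (simp_all only: mult_le_cancel_left_pos)
  then consider "int k + 1 - 2 * int mu = 0" | "int k + 1 - 2 * int mu = 1"
    by linarith
  then show False
  proof cases
    case 1
    then have "t = 0"
      using t_eq by simp
    then have disj: "?O x \<inter> ?I x = {}" for x
      using t_card[of x] by simp
    then have "card (?O x \<union> ?I x) = v - 1" for x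
      using v by (simp add: card_Un_disjoint card_out_neighbours card_in_neighbours)
    then have "?O x \<union> ?I x = UNIV - {x}" for x
      using sub by (intro card_subset_eq) (simp_all only: card_others Un_subset_iff, simp)
    then have "(x, y) \<in> parcs G \<or> (y, x) \<in> parcs G \<longleftrightarrow> x \<noteq> y" for x y
      by blast
    moreover have "\<not> ((x, y) \<in> parcs G \<and> (y, x) \<in> parcs G)" for x y
      using disj[of x] by blast
    ultimately have "adjacency_matrix G + transpose (adjacency_matrix G) = all_ones - mat 1"
      by (auto simp: vec_eq_iff adjacency_matrix_def transpose_def all_ones_def mat_def)
    then show False
      using nhadamard by simp
  next
    case 2
    then have "t = k"
      using t_eq by simp
    then have "?O x \<inter> ?I x = ?O x" for x
      by (intro card_subset_eq) (simp_all add: t_card card_out_neighbours)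
    then have "(x, y) \<in> parcs G \<Longrightarrow> (y, x) \<in> parcs G" for x y
      by blast
    then show False
      using nsym unfolding entry by (auto simp: transpose_def adjacency_matrix_def split: if_splits)
  qed
qed

text \<open>
  The numbers \<open>i\<close> and \<open>j\<close> are the traces of \<open>\<phi>\<close> on the eigenspaces of \<open>\<alpha>\<close> and \<open>\<beta>\<close>. The two equations
  compute the traces of \<open>P\<close> and \<open>P A\<close> over the decomposition into eigenspaces, with the all-ones
  vector contributing \<open>1\<close> and \<open>k\<close>.
\<close>

lemma permuted_traces:
  fixes \<alpha> \<beta> :: int
  assumes "\<beta> < \<alpha>"
    and eig: "\<alpha> + \<beta> = int lam - int mu" "\<alpha> * \<beta> = int mu - int t"
    and aut: "digraph_automorphism G \<phi>"
  obtains i j where "1 + i + j = int (card {x. \<phi> x = x})"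
    "int k + i * \<alpha> + j * \<beta> = int (card {x. (x, \<phi> x) \<in> parcs G})"
    "\<phi> = id \<Longrightarrow> 0 \<le> i \<and> 0 \<le> j"
proof -
  define f where "f = int (card {x. \<phi> x = x})"
  define g where "g = int (card {x. (x, \<phi> x) \<in> parcs G})"
  obtain i where i: "g - \<beta> * f - (int k - \<beta>) = (\<alpha> - \<beta>) * i"
    using permuted_trace_congruence[OF eig aut] unfolding f_def g_def by blast
  define j where "j = f - 1 - i"
  have "0 \<le> i \<and> 0 \<le> j" if "\<phi> = id"
  proof -
    obtain m where m: "- \<beta> * int v - (int k - \<beta>) = (\<alpha> - \<beta>) * int m"
      using eigenvalue_multiplicity[of \<alpha> \<beta>] eig by auto
    obtain m' where m': "- \<alpha> * int v - (int k - \<alpha>) = (\<beta> - \<alpha>) * int m'"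
      using eigenvalue_multiplicity[of \<beta> \<alpha>] eig by (auto simp: ac_simps)
    have fg: "f = int v" "g = 0"
      using that no_loop order_eq by (simp_all add: f_def g_def)
    have "(\<alpha> - \<beta>) * i = (\<alpha> - \<beta>) * int m"
      using i m fg by simp
    then have "i = int m"
      using \<open>\<beta> < \<alpha>\<close> by simp
    moreover have "(\<alpha> - \<beta>) * j = (\<alpha> - \<beta>) * int m'"
      using i m' fg by (simp add: j_def algebra_simps)
    then have "j = int m'"
      using \<open>\<beta> < \<alpha>\<close> by simp
    ultimately show ?thesis
      by simp
  qed
  moreover have "1 + i + j = f"
    by (simp add: j_def)
  moreover have "int k + i * \<alpha> + j * \<beta> = g"
    using i by (simp add: j_def algebra_simps)
  ultimately show ?thesis
    using that unfolding f_def g_def by blast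
qed

end

section \<open>Weighted sums of Moebius values over divisors\<close>

text \<open>
  Positivity of the order is what makes the divisors of \<open>n\<close> a finite set.
\<close>

lemma permutation_order_pos:
  fixes \<phi> :: "'v::finite \<Rightarrow> 'v"
  assumes "bij \<phi>"
  shows "0 < permutation_order \<phi>" and "\<phi> ^^ permutation_order \<phi> = id"
proof -
  have "finite (range (\<lambda>i::nat. \<phi> ^^ i))"
    by (rule finite)
  then have "\<not> inj (\<lambda>i::nat. \<phi> ^^ i)"
    using range_inj_infinite by blast
  then obtain i j where "i < j" "\<phi> ^^ i = \<phi> ^^ j"
    unfolding inj_def by (metis linorder_neqE_nat)
  then have "\<phi> ^^ i \<circ> \<phi> ^^ (j - i) = \<phi> ^^ i \<circ> id"
    unfolding funpow_add[symmetric] by simp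
  moreover have "inj (\<phi> ^^ i)"
    using assms by (intro inj_fn) (simp add: bij_is_inj)
  ultimately have "\<phi> ^^ (j - i) = id"
    by (simp add: fun_eq_iff inj_eq)
  then have "\<exists>m. 0 < m \<and> \<phi> ^^ m = id"
    using \<open>i < j\<close> by (intro exI[of _ "j - i"]) simp
  then have "0 < permutation_order \<phi> \<and> \<phi> ^^ permutation_order \<phi> = id"
    unfolding permutation_order_def by (rule LeastI_ex)
  then show "0 < permutation_order \<phi>" "\<phi> ^^ permutation_order \<phi> = id"
    by simp_all
qed

lemma moebius_mu_1: "moebius_mu 1 = 1"
  by (simp add: moebius_mu_def)

lemma moebius_mu_prime: "prime p \<Longrightarrow> moebius_mu p = - 1"
  by (simp add: moebius_mu_def squarefree_prime prime_prime_factors)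

text \<open>
  A nonnegative \<open>z\<close> is obtained from the divisor \<open>1\<close> alone, a negative one from a single prime
  divisor, where the Moebius function is \<open>-1\<close>.
\<close>

lemma moebius_sum_represents:
  fixes z :: int
  assumes "n > 0" and "n = 1 \<Longrightarrow> 0 \<le> z"
  obtains a :: "nat \<Rightarrow> nat" where "(\<Sum>d | d dvd n. int (a d) * moebius_mu d) = z"
proof (cases "0 \<le> z")
  case True
  have "(\<Sum>d | d dvd n. int (if d = 1 then nat z else 0) * moebius_mu d)
      = (\<Sum>d\<in>{1}. int (if d = 1 then nat z else 0) * moebius_mu d)"
    using \<open>n > 0\<close> by (intro sum.mono_neutral_right) auto
  then show ?thesis
    using True that[of "\<lambda>d. if d = 1 then nat z else 0"] by (simp add: moebius_mu_1[simplified])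
next
  case False
  then obtain p where p: "prime p" "p dvd n"
    using assms prime_factor_nat[of n] by auto
  have "(\<Sum>d | d dvd n. int (if d = p then nat (- z) else 0) * moebius_mu d)
      = (\<Sum>d\<in>{p}. int (if d = p then nat (- z) else 0) * moebius_mu d)"
    using \<open>n > 0\<close> p by (intro sum.mono_neutral_right) auto
  then show ?thesis
    using False that[of "\<lambda>d. if d = p then nat (- z) else 0"] by (simp add: moebius_mu_prime p)
qed

section \<open>Fixed vertices and vertices adjacent to their image\<close>

theorem theorem2p3:
  fixes G :: "'v::finite pair_pre_digraph"
    and A :: "int ^ 'v ^ 'v"
    and v k t lam mu n f g :: nat
    and \<phi> :: "'v \<Rightarrow> 'v"
    and D :: real
  assumes "directed_srg G v k t lam mu"
    and "A = adjacency_matrix G"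
    and "A \<noteq> transpose A"
    and "A \<noteq> all_ones - mat 1"
    and "A + transpose A \<noteq> all_ones - mat 1"
    and "D = (real lam - real mu)\<^sup>2 + 4 * (real t - real mu)"
    and "digraph_automorphism G \<phi>"
    and "permutation_order \<phi> = n"
    and "f = card {x. \<phi> x = x}"
    and "g = card {x. (x, \<phi> x) \<in> parcs G}"
  shows "\<exists>\<kappa>2 \<kappa>3 :: int.
    real_of_int \<kappa>2 = 1 / 2 * (real lam - real mu + sqrt D) \<and>
    real_of_int \<kappa>3 = 1 / 2 * (real lam - real mu - sqrt D) \<and>
    (\<forall>r::int. \<exists>a b :: nat \<Rightarrow> nat.
      int k - r + (\<Sum>d | d dvd n. int (a d) * moebius_mu d * (\<kappa>2 - r))
                + (\<Sum>d | d dvd n. int (b d) * moebius_mu d * (\<kappa>3 - r))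
        = - r * int f + int g) \<and>
    (\<exists>a b :: nat \<Rightarrow> nat.
      int k - \<kappa>3 + (\<Sum>d | d dvd n. int (a d) * moebius_mu d * (\<kappa>2 - \<kappa>3))
                  + (\<Sum>d | d dvd n. int (b d) * moebius_mu d * (\<kappa>3 - \<kappa>3))
        = - \<kappa>3 * int f + int g \<and>
      int k - \<kappa>3 + (\<Sum>d | d dvd n. int (a d) * moebius_mu d * (\<kappa>2 - \<kappa>3))
        = - \<kappa>3 * int f + int g) \<and>
    [int k - \<kappa>3 = - \<kappa>3 * int f + int g] (mod (\<kappa>2 - \<kappa>3))"
proof -
  interpret directed_srg G v k t lam mu
    by fact
  have "bij \<phi>"
    using assms(7) verts_UNIV by (simp add: digraph_automorphism_def)
  obtain \<kappa>2 \<kappa>3 :: int where less: "\<kappa>3 < \<kappa>2"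
    and eig: "\<kappa>2 + \<kappa>3 = int lam - int mu" "\<kappa>2 * \<kappa>3 = int mu - int t"
    using integral_eigenvalues[OF exceptional_parameters[OF assms(3-5)[unfolded assms(2)]]] .
  have real_eig: "real lam - real mu = of_int (\<kappa>2 + \<kappa>3)" "real mu - real t = of_int (\<kappa>2 * \<kappa>3)"
    unfolding eig by simp_all
  have "D = (real_of_int (\<kappa>2 - \<kappa>3))\<^sup>2"
  proof -
    have "D = (real lam - real mu)\<^sup>2 - 4 * (real mu - real t)"
      using assms(6) by simp
    also have "\<dots> = (real_of_int (\<kappa>2 - \<kappa>3))\<^sup>2"
      unfolding real_eig by (simp add: power2_eq_square algebra_simps)
    finally show ?thesis .
  qed
  then have sqrt_D: "sqrt D = of_int (\<kappa>2 - \<kappa>3)"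
    using less by simp
  obtain i j where traces: "1 + i + j = int f" "int k + i * \<kappa>2 + j * \<kappa>3 = int g"
    and nonneg: "\<phi> = id \<Longrightarrow> 0 \<le> i \<and> 0 \<le> j"
    using permuted_traces[OF less eig assms(7), folded assms(9,10)] by blast
  have "n > 0" and "n = 1 \<Longrightarrow> \<phi> = id"
    using permutation_order_pos[OF \<open>bij \<phi>\<close>] assms(8) by auto
  then have nonneg': "n = 1 \<Longrightarrow> 0 \<le> i" "n = 1 \<Longrightarrow> 0 \<le> j"
    using nonneg by blast+
  obtain a :: "nat \<Rightarrow> nat" where a: "(\<Sum>d | d dvd n. int (a d) * moebius_mu d) = i"
    using moebius_sum_represents[OF \<open>n > 0\<close> nonneg'(1)] .
  obtain b :: "nat \<Rightarrow> nat" where b: "(\<Sum>d | d dvd n. int (b d) * moebius_mu d) = j"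
    using moebius_sum_represents[OF \<open>n > 0\<close> nonneg'(2)] .
  have formula: "int k - r + (\<Sum>d | d dvd n. int (a d) * moebius_mu d * (\<kappa>2 - r))
      + (\<Sum>d | d dvd n. int (b d) * moebius_mu d * (\<kappa>3 - r)) = - r * int f + int g" for r
    unfolding sum_distrib_right[symmetric] a b traces[symmetric] by (simp add: algebra_simps)
  have at_\<kappa>3: "int k - \<kappa>3 + (\<Sum>d | d dvd n. int (a d) * moebius_mu d * (\<kappa>2 - \<kappa>3))
      = - \<kappa>3 * int f + int g"
    using formula[of \<kappa>3] by simp
  have "int k - \<kappa>3 + i * (\<kappa>2 - \<kappa>3) = - \<kappa>3 * int f + int g"
    using at_\<kappa>3 by (simp only: sum_distrib_right[symmetric] a)
  then have diff_eq: "int k - \<kappa>3 - (- \<kappa>3 * int f + int g) = (\<kappa>2 - \<kappa>3) * (- i)"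
    by (simp add: algebra_simps)
  show ?thesis
  proof (rule exI[of _ \<kappa>2], rule exI[of _ \<kappa>3], intro conjI allI)
    show "real_of_int \<kappa>2 = 1 / 2 * (real lam - real mu + sqrt D)"
      "real_of_int \<kappa>3 = 1 / 2 * (real lam - real mu - sqrt D)"
      unfolding sqrt_D real_eig(1) by simp_all
    show "\<exists>a b :: nat \<Rightarrow> nat.
      int k - r + (\<Sum>d | d dvd n. int (a d) * moebius_mu d * (\<kappa>2 - r))
        + (\<Sum>d | d dvd n. int (b d) * moebius_mu d * (\<kappa>3 - r)) = - r * int f + int g" for r
      using formula by (intro exI)
    show "\<exists>a b :: nat \<Rightarrow> nat.
      int k - \<kappa>3 + (\<Sum>d | d dvd n. int (a d) * moebius_mu d * (\<kappa>2 - \<kappa>3))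
        + (\<Sum>d | d dvd n. int (b d) * moebius_mu d * (\<kappa>3 - \<kappa>3)) = - \<kappa>3 * int f + int g \<and>
      int k - \<kappa>3 + (\<Sum>d | d dvd n. int (a d) * moebius_mu d * (\<kappa>2 - \<kappa>3)) = - \<kappa>3 * int f + int g"
      using formula[of \<kappa>3] at_\<kappa>3 by (intro exI conjI)
    show "[int k - \<kappa>3 = - \<kappa>3 * int f + int g] (mod (\<kappa>2 - \<kappa>3))"
      unfolding cong_iff_dvd_diff diff_eq by simp
  qed
qed

end
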